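(* Let $p,q\in L^2([0,1],\mathbb{R})$ and let $K$, $K_C$, $K_S$, $K_{ij}^{(n)}$ be the kernels and coefficients defined in the context. Then, for every $x\in(0,1]$, the integral kernels $K_C(x,\cdot)$ and $K_S(x,\cdot)$ admit the matrix Fourier-Legendre series representations $$K_C(x,t)=2\sum_{n=0}^{\infty}\frac1x K_n^C(x)A_n^C(x,t),\qquad K_S(x,t)=2\sum_{n=0}^{\infty}\frac1x K_n^S(x)A_n^S(x,t),$$ where $$K_n^C(x)=\begin{pmatrix}K_{11}^{(2n)}(x)&K_{12}^{(2n+1)}(x)\\ K_{21}^{(2n)}(x)&K_{22}^{(2n+1)}(x)\end{pmatrix},\quad A_n^C(x,t)=\begin{pmatrix}P_{2n}(t/x)&0\\ 0&P_{2n+1}(t/x)\end{pmatrix},$$ $$K_n^S(x)=\begin{pmatrix}K_{11}^{(2n+1)}(x)&K_{12}^{(2n)}(x)\\ K_{21}^{(2n+1)}(x)&K_{22}^{(2n)}(x)\end{pmatrix},\quad A_n^S(x,t)=\begin{pmatrix}P_{2n+1}(t/x)&0\\ 0&P_{2n}(t/x)\end{pmatrix},$$ and both series converge (as functions of $t$) in the norm of $L^2([0,x],\mathcal{M}_2)$.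
   Context: $\mathcal{M}_2$ is the algebra of $2\times2$ complex matrices with the operator norm $|\cdot|$ induced by the Euclidean norm of $\mathbb{C}^2$; $L^2([a,b],\mathcal{M}_2)$ is the space of $\mathcal{M}_2$-valued functions with finite norm $\|A\|=\left(\int_a^b|A(t)|^2dt\right)^{1/2}$. $P_n$ is the $n$-th Legendre polynomial. Let $B=\begin{pmatrix}0&1\\ -1&0\end{pmatrix}$, $Q(x)=\begin{pmatrix}p(x)&q(x)\\ q(x)&-p(x)\end{pmatrix}$, $\tilde\sigma_2=\begin{pmatrix}1&0\\ 0&-1\end{pmatrix}$. The Dirac equation is $BY'+Q(x)Y=\lambda Y$, $0<x<1$. It is known that there is a matrix-valued kernel $K(x,t)$ with $K(x,\cdot)\in L^2([-x,x],\mathcal{M}_2)$ such that the matrix solution $U(\lambda,x)$ of $BU'+QU=\lambda U$, $U(\lambda,0)=I$, is $U(\lambda,x)=e^{-B\lambda x}+\int_{-x}^xK(x,t)e^{-B\lambda t}dt$ for all $\lambda\in\mathbb{C}$. For $x>0$ it has the Fourier-Legendre expansion $K(x,t)=\sum_{n=0}^\infty\frac1xK_n(x)P_n(t/x)$, convergent in $L^2((-x,x),\mathcal{M}_2)$, with $K_n(x)=\left(K_{ij}^{(n)}(x)\right)_{i,j=1}^2$ (i.e. $K_n(x)=\frac{2n+1}{2}\int_{-x}^xK(x,t)P_n(t/x)\,dt$). The kernels $K_C$ and $K_S$ are, for $0\le t\le x$, $K_C(x,t)=K(x,t)+K(x,-t)\tilde\sigma_2$ and $K_S(x,t)=K(x,t)-K(x,-t)\tilde\sigma_2$.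 *)

theory Defs
  imports "HOL-Analysis.Analysis" "HOL-Computational_Algebra.Polynomial"
begin

type_synonym cmat2 = "complex^2^2"

(* Rows first: mat2 a b c d has first row a, b and second row c, d.  The matrix product is **;
   the class operations * and ^ on cmat2 are componentwise and are not used. *)
definition mat2 :: "complex \<Rightarrow> complex \<Rightarrow> complex \<Rightarrow> complex \<Rightarrow> cmat2" where
  "mat2 a b c d = vector [vector [a, b], vector [c, d]]"

definition cscale :: "complex \<Rightarrow> cmat2 \<Rightarrow> cmat2" where
  "cscale c A = map_matrix (\<lambda>z. c * z) A"

(* The class norm on cmat2 is the Frobenius norm; this is the operator norm induced by the
   Euclidean norm, which is the class norm on complex^2. *)
definition opnorm :: "cmat2 \<Rightarrow> real" where
  "opnorm A = onorm (\<lambda>v. A *v v)"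

definition mat_exp :: "cmat2 \<Rightarrow> cmat2" where
  "mat_exp A = (\<Sum>n. (1 / fact n) *\<^sub>R (((\<lambda>X. A ** X) ^^ n) (mat 1)))"

definition L2_real :: "real \<Rightarrow> real \<Rightarrow> (real \<Rightarrow> real) set" where
  "L2_real a b = {f. f \<in> borel_measurable (lebesgue_on {a..b}) \<and>
                     integrable (lebesgue_on {a..b}) (\<lambda>t. (f t)\<^sup>2)}"

definition L2_mat :: "real \<Rightarrow> real \<Rightarrow> (real \<Rightarrow> cmat2) set" where
  "L2_mat a b = {A. A \<in> borel_measurable (lebesgue_on {a..b}) \<and>
                    integrable (lebesgue_on {a..b}) (\<lambda>t. (opnorm (A t))\<^sup>2)}"

definition L2_norm :: "real \<Rightarrow> real \<Rightarrow> (real \<Rightarrow> cmat2) \<Rightarrow> real" where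
  "L2_norm a b A = sqrt (LINT t|lebesgue_on {a..b}. (opnorm (A t))\<^sup>2)"

(* Membership in L2_mat is demanded because the Bochner integral in L2_norm is 0 for
   non-integrable functions. *)
definition L2_converges ::
    "real \<Rightarrow> real \<Rightarrow> (nat \<Rightarrow> real \<Rightarrow> cmat2) \<Rightarrow> (real \<Rightarrow> cmat2) \<Rightarrow> bool" where
  "L2_converges a b F A \<longleftrightarrow>
     A \<in> L2_mat a b \<and> (\<forall>N. F N \<in> L2_mat a b) \<and>
     (\<lambda>N. L2_norm a b (\<lambda>t. F N t - A t)) \<longlonglongrightarrow> 0"

(* Rodrigues' formula *)
definition legendre :: "nat \<Rightarrow> real poly" where
  "legendre n = smult (1 / (2 ^ n * fact n)) ((pderiv ^^ n) ([:-1, 0, 1:] ^ n))"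

abbreviation legendre_P :: "nat \<Rightarrow> real \<Rightarrow> real" where
  "legendre_P n \<equiv> poly (legendre n)"

definition dirac_B :: cmat2 where
  "dirac_B = mat2 0 1 (-1) 0"

definition dirac_Q :: "(real \<Rightarrow> real) \<Rightarrow> (real \<Rightarrow> real) \<Rightarrow> real \<Rightarrow> cmat2" where
  "dirac_Q p q x = mat2 (of_real (p x)) (of_real (q x)) (of_real (q x)) (- of_real (p x))"

definition sigma2 :: cmat2 where
  "sigma2 = mat2 1 0 0 (-1)"

definition abs_continuous_on :: "real \<Rightarrow> real \<Rightarrow> (real \<Rightarrow> cmat2) \<Rightarrow> bool" where
  "abs_continuous_on a b Y \<longleftrightarrow>
     (\<forall>\<epsilon>>0. \<exists>\<delta>>0. \<forall>(m::nat) l r.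
        (\<forall>i<m. a \<le> l i \<and> l i \<le> r i \<and> r i \<le> b) \<longrightarrow>
        (\<forall>i<m. \<forall>j<m. i \<noteq> j \<longrightarrow> {l i<..<r i} \<inter> {l j<..<r j} = {}) \<longrightarrow>
        (\<Sum>i<m. r i - l i) < \<delta> \<longrightarrow>
        (\<Sum>i<m. norm (Y (r i) - Y (l i))) < \<epsilon>)"

(* Since p and q are only square integrable, solutions are understood in the Caratheodory sense. *)
definition dirac_fundamental_solution ::
    "(real \<Rightarrow> real) \<Rightarrow> (real \<Rightarrow> real) \<Rightarrow> complex \<Rightarrow> (real \<Rightarrow> cmat2) \<Rightarrow> bool" where
  "dirac_fundamental_solution p q lam Y \<longleftrightarrow>
     abs_continuous_on 0 1 Y \<and> Y 0 = mat 1 \<and>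
     (AE x in lebesgue. x \<in> {0<..<1} \<longrightarrow>
        (\<exists>Y'. (Y has_vector_derivative Y') (at x) \<and>
              dirac_B ** Y' + dirac_Q p q x ** Y x = cscale lam (Y x)))"

definition exp_B :: "complex \<Rightarrow> real \<Rightarrow> cmat2" where
  "exp_B lam t = mat_exp (cscale (- (lam * of_real t)) dirac_B)"

definition transmutation_kernel ::
    "(complex \<Rightarrow> real \<Rightarrow> cmat2) \<Rightarrow> (real \<Rightarrow> real \<Rightarrow> cmat2) \<Rightarrow> bool" where
  "transmutation_kernel U K \<longleftrightarrow>
     (\<forall>x\<in>{0<..1}. K x \<in> L2_mat (-x) x \<and>
        (\<forall>lam. U lam x = exp_B lam x + (LINT t|lebesgue_on {-x..x}. K x t ** exp_B lam t)))"

definition K_coeff :: "(real \<Rightarrow> real \<Rightarrow> cmat2) \<Rightarrow> nat \<Rightarrow> real \<Rightarrow> cmat2" where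
  "K_coeff K n x = (real (2 * n + 1) / 2) *\<^sub>R (LINT t|lebesgue_on {-x..x}. legendre_P n (t / x) *\<^sub>R K x t)"

definition K_C :: "(real \<Rightarrow> real \<Rightarrow> cmat2) \<Rightarrow> real \<Rightarrow> real \<Rightarrow> cmat2" where
  "K_C K x t = K x t + K x (-t) ** sigma2"

definition K_S :: "(real \<Rightarrow> real \<Rightarrow> cmat2) \<Rightarrow> real \<Rightarrow> real \<Rightarrow> cmat2" where
  "K_S K x t = K x t - K x (-t) ** sigma2"

definition KC_coeff :: "(real \<Rightarrow> real \<Rightarrow> cmat2) \<Rightarrow> nat \<Rightarrow> real \<Rightarrow> cmat2" where
  "KC_coeff K n x =
     mat2 (K_coeff K (2*n) x $ 1 $ 1) (K_coeff K (2*n+1) x $ 1 $ 2)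
          (K_coeff K (2*n) x $ 2 $ 1) (K_coeff K (2*n+1) x $ 2 $ 2)"

definition KS_coeff :: "(real \<Rightarrow> real \<Rightarrow> cmat2) \<Rightarrow> nat \<Rightarrow> real \<Rightarrow> cmat2" where
  "KS_coeff K n x =
     mat2 (K_coeff K (2*n+1) x $ 1 $ 1) (K_coeff K (2*n) x $ 1 $ 2)
          (K_coeff K (2*n+1) x $ 2 $ 1) (K_coeff K (2*n) x $ 2 $ 2)"

definition A_C :: "nat \<Rightarrow> real \<Rightarrow> real \<Rightarrow> cmat2" where
  "A_C n x t = mat2 (of_real (legendre_P (2*n) (t/x))) 0 0 (of_real (legendre_P (2*n+1) (t/x)))"

definition A_S :: "nat \<Rightarrow> real \<Rightarrow> real \<Rightarrow> cmat2" where
  "A_S n x t = mat2 (of_real (legendre_P (2*n+1) (t/x))) 0 0 (of_real (legendre_P (2*n) (t/x)))"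

end

theory Submission
  imports Defs
begin

text \<open>
  For fixed \<open>x\<close> both expansions are instances of one fact: the Fourier-Legendre series of a
  square integrable function on \<open>[-x, x]\<close> converges to it in the mean.

  Let \<open>S\<close> be the partial sum of length \<open>2 N\<close> of the Legendre series of \<open>K x\<close>. Since
  \<open>P\<^sub>n\<close> has the parity of \<open>n\<close>, adding \<open>S t\<close> and \<open>S (-t) ** sigma2\<close> doubles the even
  Legendre terms in the first column and the odd ones in the second, and cancels the rest. This
  is exactly the \<open>N\<close>-th partial sum claimed for \<open>K_C\<close>; subtracting instead of adding exchanges the
  roles of the two columns and gives the one for \<open>K_S\<close> (lemmas \<open>KC_sum_eq_folded_legendre_sum\<close> and
  \<open>KS_sum_eq_folded_legendre_sum\<close>). As \<open>K_C\<close> and \<open>K_S\<close> arise from \<open>K\<close> by the same folding,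
  the error on \<open>[0, x]\<close> is the folded error \<open>S - K x\<close>. Right multiplication by \<open>sigma2\<close> is an
  isometry and \<open>t \<mapsto> -t\<close> preserves Lebesgue measure, so folding is bounded in the square
  mean (\<open>square_integrable_fold\<close>) and the error tends to 0.

  The convergence of the Legendre series (\<open>legendre_sum_tendsto\<close>) is the usual Hilbert space
  argument. By Rodrigues' formula and integration by parts the Legendre polynomials are orthogonal
  (\<open>poly_int_legendre\<close>), and those of index below \<open>N\<close> span all polynomials of degree below
  \<open>N\<close>; so the partial sum is the best approximation among these polynomials
  (\<open>legendre_sum_best_approximation\<close>). Polynomials are dense in the square mean
  (\<open>polynomials_dense_L2\<close>): truncate the function, approximate the truncation by a continuous
  function, and apply Weierstrass' theorem. Vector-valued functions are treated
  coordinatewise. All estimates are made for the Euclidean (Frobenius) norm of matrices, which is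
  equivalent to the operator norm.
\<close>

section \<open>Orthogonality of the Legendre polynomials\<close>

definition poly_int :: "real poly \<Rightarrow> real" where
  "poly_int p = integral {-1..1} (poly p)"

lemma poly_int_integrable: "poly p integrable_on {-1..1::real}"
  by (intro integrable_continuous_real continuous_intros)

lemma poly_int_add: "poly_int (p + q) = poly_int p + poly_int q"
proof -
  have "poly (p + q) = (\<lambda>t. poly p t + poly q t)"
    by auto
  then show ?thesis
    by (simp add: poly_int_def integral_add poly_int_integrable)
qed

lemma poly_int_smult: "poly_int (smult c p) = c * poly_int p"
proof -
  have "poly (smult c p) = (\<lambda>t. c * poly p t)"
    by auto
  then show ?thesis
    by (simp add: poly_int_def)
qed

lemma poly_int_0: "poly_int 0 = 0"
  using poly_int_smult[of 0 0] by simp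

lemma poly_int_pderiv: "poly_int (pderiv p) = poly p 1 - poly p (-1)"
  unfolding poly_int_def
  by (intro integral_unique fundamental_theorem_of_calculus)
     (auto intro!: DERIV_subset[OF poly_DERIV] simp flip: has_real_derivative_iff_has_vector_derivative)

lemma poly_int_by_parts:
  assumes "poly p 1 = 0" "poly p (-1) = 0"
  shows "poly_int (pderiv p * q) = - poly_int (p * pderiv q)"
proof -
  have "poly_int (pderiv (p * q)) = 0"
    using assms by (simp add: poly_int_pderiv)
  then show ?thesis
    by (simp add: pderiv_mult poly_int_add mult.commute)
qed

text \<open>
  Each differentiation destroys at most one factor of a power. This makes the boundary terms in the
  repeated integration by parts of Rodrigues' formula vanish.
\<close>

lemma power_dvd_higher_pderiv:
  fixes p :: "'a::idom poly"
  assumes "k \<le> n"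
  shows "p ^ (n - k) dvd (pderiv ^^ k) (p ^ n)"
  using assms
proof (induction k)
  case (Suc k)
  then obtain r where r: "(pderiv ^^ k) (p ^ n) = p ^ Suc (n - Suc k) * r"
    by (metis Suc_diff_Suc Suc_leD Suc_le_lessD dvd_def)
  show ?case
    by (simp only: funpow.simps comp_apply r pderiv_mult pderiv_power_Suc)
       (intro dvd_add dvd_mult2 dvd_mult dvd_smult dvd_refl; simp)
qed simp

text \<open>
  Each of the \<open>k\<close> integrations by parts moves one derivative to \<open>q\<close>. The boundary terms
  vanish because a derivative of order below \<open>n\<close> of \<open>(t\<^sup>2 - 1)^n\<close> is still divisible by
  \<open>t\<^sup>2 - 1\<close>.
\<close>

lemma poly_int_rodrigues_by_parts:
  assumes "k \<le> n"
  shows "poly_int ((pderiv ^^ n) ([:-1, 0, 1:] ^ n) * q) =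
    (-1) ^ k * poly_int ((pderiv ^^ (n - k)) ([:-1, 0, 1:] ^ n) * (pderiv ^^ k) q)"
  using assms
proof (induction k)
  case (Suc k)
  let ?D = "\<lambda>j. (pderiv ^^ j) ([:-1, 0, 1:] ^ n :: real poly)"
  have "[:-1, 0, 1:] dvd ?D (n - Suc k)"
    using power_dvd_higher_pderiv[of "n - Suc k" n "[:-1, 0, 1:] :: real poly"] Suc.prems
    by (metis diff_diff_cancel diff_le_self dvd_power dvd_trans zero_less_Suc)
  then have "poly (?D (n - Suc k)) 1 = 0" "poly (?D (n - Suc k)) (-1) = 0"
    by (auto elim!: dvdE)
  note parts = poly_int_by_parts[OF this]
  have "?D (n - k) = pderiv (?D (n - Suc k))"
    using Suc.prems by (metis Suc_diff_Suc Suc_le_lessD comp_apply funpow.simps(2))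
  then show ?case
    using Suc by (simp add: parts)
qed simp

lemma degree_legendre: "degree (legendre n) = n"
  by (simp add: legendre_def degree_higher_pderiv degree_power_eq)

text \<open>Moving all \<open>n\<close> derivatives of Rodrigues' formula to \<open>q\<close> annihilates \<open>q\<close>.\<close>

lemma legendre_orthogonal_lower_degree:
  assumes "degree q < n"
  shows "poly_int (legendre n * q) = 0"
proof -
  have "(pderiv ^^ n) q = 0"
    using assms by (intro poly_eqI) (simp add: coeff_higher_pderiv coeff_eq_0)
  then show ?thesis
    using poly_int_rodrigues_by_parts[of n n q] by (simp add: legendre_def poly_int_smult poly_int_0)
qed

text \<open>
  Integrating the derivative of \<open>t (t\<^sup>2 - 1)^(n + 1)\<close>, which vanishes at both endpoints, gives a
  recurrence in \<open>n\<close>.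
\<close>

lemma poly_int_weight_power:
  "poly_int ([:-1, 0, 1:] ^ n) = (-1) ^ n * 2 ^ (2 * n + 1) * (fact n)\<^sup>2 / fact (2 * n + 1)"
proof (induction n)
  case 0
  have "pderiv [:0, 1::real:] = 1"
    by (simp add: pderiv_pCons one_pCons)
  then have "poly_int 1 = 2"
    using poly_int_pderiv[of "[:0, 1:]"] by simp
  then show ?case
    by simp
next
  case (Suc n)
  let ?w = "[:-1, 0, 1:] :: real poly"
  have *: "pderiv ([:0, 1:] * ?w ^ Suc n) = smult (2 * n + 3) (?w ^ Suc n) + smult (2 * n + 2) (?w ^ n)"
    unfolding poly_eq_poly_eq_iff[symmetric] pderiv_mult pderiv_power_Suc
    by (simp add: fun_eq_iff pderiv_pCons algebra_simps)
  have "poly_int (smult (2 * n + 3) (?w ^ Suc n) + smult (2 * n + 2) (?w ^ n)) = 0"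
    unfolding *[symmetric] poly_int_pderiv by simp
  then have **: "(2 * n + 3) * poly_int (?w ^ Suc n) = - ((2 * n + 2) * poly_int (?w ^ n))"
    by (simp only: poly_int_add poly_int_smult)
  have f: "fact (2 * Suc n + 1) = (2 * real n + 3) * (2 * n + 2) * fact (2 * n + 1)"
    by (simp add: algebra_simps)
  have "poly_int (?w ^ Suc n) = - ((2 * n + 2) / (2 * n + 3) * poly_int (?w ^ n))"
    using ** by (simp add: field_simps)
  also have "\<dots> = (-1) ^ Suc n * 2 ^ (2 * Suc n + 1) * (fact (Suc n))\<^sup>2 / fact (2 * Suc n + 1)"
    unfolding f Suc.IH by (simp add: divide_simps power2_eq_square del: fact_Suc) (simp add: algebra_simps)
  finally show ?case .
qed

lemma higher_pderiv_weight_power: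
  "(pderiv ^^ (2 * n)) ([:-1, 0, 1:] ^ n) = [:fact (2 * n) :: real:]"
proof (rule poly_eqI)
  fix i
  have deg: "degree ([:-1, 0, 1:] ^ n :: real poly) = 2 * n"
    by (simp add: degree_power_eq)
  have lead: "coeff ([:-1, 0, 1:] ^ n :: real poly) (2 * n) = 1"
    using lead_coeff_power[of "[:-1, 0, 1:] :: real poly" n] deg by simp
  show "coeff ((pderiv ^^ (2 * n)) ([:-1, 0, 1:] ^ n)) i = coeff [:fact (2 * n) :: real:] i"
  proof (cases i)
    case 0
    then show ?thesis
      using lead by (simp add: coeff_higher_pderiv pochhammer_fact)
  next
    case (Suc j)
    then show ?thesis
      by (simp add: coeff_higher_pderiv coeff_eq_0 degree_power_eq)
  qed
qed

text \<open>
  Moving all derivatives to the second factor turns it into the constant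
  \<open>(2 n)!\<close>, the leading coefficient of \<open>(t\<^sup>2 - 1)^n\<close> being 1. What remains is the integral of
  \<open>(t\<^sup>2 - 1)^n\<close>.
\<close>

lemma poly_int_legendre_square: "poly_int (legendre n * legendre n) = 2 / (2 * n + 1)"
proof -
  let ?D = "\<lambda>j. (pderiv ^^ j) ([:-1, 0, 1:] ^ n :: real poly)"
  have "poly_int (?D n * ?D n) = (-1) ^ n * poly_int ([:-1, 0, 1:] ^ n * (pderiv ^^ n) (?D n))"
    using poly_int_rodrigues_by_parts[of n n "?D n"] by simp
  also have "(pderiv ^^ n) (?D n) = [:fact (2 * n):]"
    unfolding higher_pderiv_weight_power[symmetric] by (simp add: mult_2 funpow_add)
  also have "(-1) ^ n * poly_int ([:-1, 0, 1:] ^ n * [:fact (2 * n):]) =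
      2 ^ (2 * n + 1) * (fact n)\<^sup>2 / real (2 * n + 1)"
    by (simp add: poly_int_smult poly_int_weight_power flip: power_mult_distrib)
  finally show ?thesis
    by (simp add: legendre_def poly_int_smult power2_eq_square field_simps flip: power_add mult_2)
qed

lemma poly_int_legendre:
  "poly_int (legendre m * legendre n) = (if m = n then 2 / (2 * n + 1) else 0)"
proof (cases m n rule: linorder_cases)
  case less
  then show ?thesis
    using legendre_orthogonal_lower_degree[of "legendre m" n] by (simp add: degree_legendre mult.commute)
qed (auto simp: poly_int_legendre_square legendre_orthogonal_lower_degree degree_legendre)

text \<open>
  The polynomial \<open>(t\<^sup>2 - 1)^n\<close> is even, and each of the \<open>n\<close> differentiations changes the
  parity.
\<close>

lemma legendre_minus: "poly (legendre n) (- t) = (-1) ^ n * poly (legendre n) t"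
proof -
  let ?D = "(pderiv ^^ n) ([:-1, 0, 1:] ^ n) :: real poly"
  have reflect: "(pderiv ^^ k) (p \<circ>\<^sub>p [:0, -1:]) = smult ((-1) ^ k) ((pderiv ^^ k) p \<circ>\<^sub>p [:0, -1:])"
    for k and p :: "real poly"
    by (induction k) (simp_all add: pderiv_smult pderiv_pcompose pderiv_pCons)
  have "[:-1, 0, 1:] ^ n \<circ>\<^sub>p [:0, -1::real:] = [:-1, 0, 1:] ^ n"
    unfolding poly_eq_poly_eq_iff[symmetric] by (simp add: fun_eq_iff poly_pcompose)
  then have D: "?D = smult ((-1) ^ n) (?D \<circ>\<^sub>p [:0, -1:])"
    using reflect[of n "[:-1, 0, 1:] ^ n"] by simp
  have Dr: "smult ((-1) ^ n) ?D = ?D \<circ>\<^sub>p [:0, -1:]"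
    by (subst D) (simp flip: power_mult_distrib)
  have "legendre n \<circ>\<^sub>p [:0, -1:] = smult ((-1) ^ n) (legendre n)"
    by (simp add: legendre_def pcompose_smult mult.commute flip: Dr)
  then have "poly (legendre n \<circ>\<^sub>p [:0, -1:]) t = (-1) ^ n * poly (legendre n) t"
    by simp
  then show ?thesis
    by (simp add: poly_pcompose)
qed

lemma poly_eq_sum_legendre:
  assumes "degree q < N"
  shows "\<exists>a. q = (\<Sum>n<N. smult (a n) (legendre n))"
  using assms
proof (induction N arbitrary: q)
  case (Suc N)
  define c where "c = coeff q N / lead_coeff (legendre N)"
  define r where "r = q - smult c (legendre N)"
  \<comment> \<open>For \<open>N = 0\<close> the degree does not show this, as \<open>0\<close> also has degree \<open>0\<close>; the norm does.\<close>
  have "lead_coeff (legendre N) \<noteq> 0"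
    using poly_int_legendre_square[of N] by (auto simp: poly_int_0)
  then have "coeff r N = 0"
    by (simp add: r_def c_def degree_legendre)
  moreover have "degree r \<le> N"
    using Suc.prems by (simp add: r_def degree_diff_le degree_legendre le_trans[OF degree_smult_le])
  ultimately have r: "r = 0 \<or> degree r < N"
    by (metis leading_coeff_0_iff order_le_less)
  have "\<exists>a. r = (\<Sum>n<N. smult (a n) (legendre n))"
  proof (cases "r = 0")
    case True
    then show ?thesis
      by (intro exI[of _ "\<lambda>_. 0"]) simp
  qed (use r Suc.IH in blast)
  then obtain a where a: "r = (\<Sum>n<N. smult (a n) (legendre n))"
    by blast
  have "q = (\<Sum>n<Suc N. smult ((a(N := c)) n) (legendre n))"
    using a by (simp add: r_def diff_eq_eq)
  then show ?case
    by blast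
qed simp

section \<open>Square integrable functions\<close>

definition square_integrable :: "'s measure \<Rightarrow> ('s \<Rightarrow> 'a::euclidean_space) \<Rightarrow> bool" where
  "square_integrable M f \<longleftrightarrow>
     f \<in> borel_measurable M \<and> integrable M (\<lambda>t. (norm (f t))\<^sup>2)"

lemma square_integrable_measurable [measurable_dest]:
  "square_integrable M f \<Longrightarrow> f \<in> borel_measurable M"
  by (simp add: square_integrable_def)

lemma square_integrable_norm:
  "square_integrable M f \<Longrightarrow> integrable M (\<lambda>t. (norm (f t))\<^sup>2)"
  by (simp add: square_integrable_def)

lemma square_integrable_real:
  "square_integrable M f \<Longrightarrow> integrable M (\<lambda>t. (f t :: real)\<^sup>2)"
  by (simp add: square_integrable_def)

lemma square_integrableI_bound:
  assumes [measurable]: "f \<in> borel_measurable M"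
    and "integrable M g" and "\<And>t. t \<in> space M \<Longrightarrow> (norm (f t))\<^sup>2 \<le> g t"
  shows "square_integrable M f"
  unfolding square_integrable_def
  by (intro conjI Bochner_Integration.integrable_bound[OF assms(2)] AE_I2) (use assms(3) in \<open>force+\<close>)

lemma norm_add_square_le:
  fixes u v :: "'a::real_normed_vector"
  shows "(norm (u + v))\<^sup>2 \<le> 2 * (norm u)\<^sup>2 + 2 * (norm v)\<^sup>2"
proof -
  have "(norm (u + v))\<^sup>2 \<le> (norm u + norm v)\<^sup>2"
    by (simp add: norm_triangle_ineq power_mono)
  also have "\<dots> \<le> 2 * (norm u)\<^sup>2 + 2 * (norm v)\<^sup>2"
    using sum_squares_bound[of "norm u" "norm v"] by (simp add: power2_sum)
  finally show ?thesis .
qed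

lemma square_integrable_add:
  assumes f: "square_integrable M f" and g: "square_integrable M g"
  shows "square_integrable M (\<lambda>t. f t + g t)"
proof (rule square_integrableI_bound)
  show "(\<lambda>t. f t + g t) \<in> borel_measurable M"
    using f g by measurable
  show "integrable M (\<lambda>t. 2 * (norm (f t))\<^sup>2 + 2 * (norm (g t))\<^sup>2)"
    using f g by (simp add: square_integrable_norm)
qed (rule norm_add_square_le)

lemma square_integrable_linear:
  assumes f: "square_integrable M f" and h: "bounded_linear h"
  shows "square_integrable M (\<lambda>t. h (f t))"
proof (rule square_integrableI_bound)
  show "(\<lambda>t. h (f t)) \<in> borel_measurable M"
    using measurable_compose[OF square_integrable_measurable[OF f]
        borel_measurable_continuous_onI[OF linear_continuous_on[OF h]]] .
  show "integrable M (\<lambda>t. (onorm h)\<^sup>2 * (norm (f t))\<^sup>2)"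
    using f by (simp add: square_integrable_norm)
  show "(norm (h (f t)))\<^sup>2 \<le> (onorm h)\<^sup>2 * (norm (f t))\<^sup>2" for t
    using onorm[OF h] by (simp add: power_mono flip: power_mult_distrib)
qed

lemma square_integrable_diff:
  assumes "square_integrable M f" "square_integrable M g"
  shows "square_integrable M (\<lambda>t. f t - g t)"
  using square_integrable_add[OF assms(1) square_integrable_linear[OF assms(2) bounded_linear_minus[OF bounded_linear_ident]]]
  by simp

lemma square_integrable_scaleR_integrable:
  assumes g: "square_integrable M (g :: _ \<Rightarrow> real)" and f: "square_integrable M f"
  shows "integrable M (\<lambda>t. g t *\<^sub>R f t)"
proof (rule Bochner_Integration.integrable_bound)
  show "integrable M (\<lambda>t. (g t)\<^sup>2 + (norm (f t))\<^sup>2)"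
    using f g by (simp add: square_integrable_norm square_integrable_real)
  show "(\<lambda>t. g t *\<^sub>R f t) \<in> borel_measurable M"
    using f g by measurable
  have "\<bar>g t\<bar> * norm (f t) \<le> (g t)\<^sup>2 + (norm (f t))\<^sup>2" for t
  proof -
    have "2 * (\<bar>g t\<bar> * norm (f t)) \<le> (g t)\<^sup>2 + (norm (f t))\<^sup>2"
      using sum_squares_bound[of "\<bar>g t\<bar>" "norm (f t)"] by (simp add: mult.assoc)
    moreover have "0 \<le> \<bar>g t\<bar> * norm (f t)"
      by simp
    ultimately show ?thesis
      by linarith
  qed
  then show "AE t in M. norm (g t *\<^sub>R f t) \<le> norm ((g t)\<^sup>2 + (norm (f t))\<^sup>2)"
    by (intro AE_I2) auto
qed

lemma square_integrable_continuous:
  fixes f :: "real \<Rightarrow> 'a::euclidean_space"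
  assumes "continuous_on {a..b} f"
  shows "square_integrable (lebesgue_on {a..b}) f"
  unfolding square_integrable_def
proof
  show "f \<in> borel_measurable (lebesgue_on {a..b})"
    using assms by (intro continuous_imp_measurable_on_sets_lebesgue) auto
  show "integrable (lebesgue_on {a..b}) (\<lambda>t. (norm (f t))\<^sup>2)"
    using assms by (intro continuous_imp_integrable_real continuous_intros)
qed

lemma square_integrable_imp_integrable:
  fixes f :: "real \<Rightarrow> 'a::euclidean_space"
  assumes "square_integrable (lebesgue_on {a..b}) f"
  shows "integrable (lebesgue_on {a..b}) f"
  using square_integrable_scaleR_integrable[OF square_integrable_continuous[of a b "\<lambda>_. 1"] assms]
  by simp

section \<open>Legendre partial sums as best approximations\<close>

text \<open>
  The factor \<open>(2 n + 1) / (2 x)\<close> is the reciprocal of the integral of \<open>P\<^sub>n(t / x)\<^sup>2\<close> over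
  \<open>[-x, x]\<close>.
\<close>

definition legendre_coeff :: "real \<Rightarrow> (real \<Rightarrow> 'a::euclidean_space) \<Rightarrow> nat \<Rightarrow> 'a" where
  "legendre_coeff x f n =
     ((2 * n + 1) / (2 * x)) *\<^sub>R (LINT t|lebesgue_on {-x..x}. legendre_P n (t / x) *\<^sub>R f t)"

definition legendre_sum :: "real \<Rightarrow> (real \<Rightarrow> 'a::euclidean_space) \<Rightarrow> nat \<Rightarrow> real \<Rightarrow> 'a" where
  "legendre_sum x f N t = (\<Sum>n<N. legendre_P n (t / x) *\<^sub>R legendre_coeff x f n)"

lemma continuous_on_legendre_sum: "continuous_on S (legendre_sum x f N)"
  unfolding legendre_sum_def divide_inverse by (intro continuous_intros)

lemma square_integrable_legendre_error:
  assumes "square_integrable (lebesgue_on {-x..x}) f"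
  shows "square_integrable (lebesgue_on {-x..x}) (\<lambda>t. f t - legendre_sum x f N t)"
  by (intro square_integrable_diff assms square_integrable_continuous continuous_on_legendre_sum)

lemma continuous_on_poly_scaled: "continuous_on S (\<lambda>t. poly p (t / x :: real))"
  unfolding divide_inverse by (intro continuous_intros)

lemma integral_poly_scaled:
  assumes "x > 0"
  shows "(LINT t|lebesgue_on {-x..x}. poly p (t / x)) = x * poly_int p"
proof -
  have "((\<lambda>t. poly p (t / x)) has_integral (x * poly_int p)) {-x..x}"
    using has_integral_affinity'[of "poly p" "poly_int p" "-1" 1 "1 / x" 0] assms
    by (auto simp: poly_int_def poly_int_integrable integrable_integral field_simps)
  moreover have "(LINT t|lebesgue_on {-x..x}. poly p (t / x)) = integral {-x..x} (\<lambda>t. poly p (t / x))"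
    by (intro lebesgue_integral_eq_integral continuous_imp_integrable_real continuous_on_poly_scaled) auto
  ultimately show ?thesis
    by (simp add: integral_unique)
qed

lemma legendre_error_orthogonal_legendre:
  fixes f :: "real \<Rightarrow> real"
  assumes x: "x > 0" and f: "square_integrable (lebesgue_on {-x..x}) f" and m: "m < N"
  shows "(LINT t|lebesgue_on {-x..x}. (f t - legendre_sum x f N t) * legendre_P m (t / x)) = 0"
proof -
  let ?M = "lebesgue_on {-x..x}"
  let ?P = "\<lambda>n t. legendre_P n (t / x)"
  have fm: "integrable ?M (\<lambda>t. f t * ?P m t)"
    using square_integrable_scaleR_integrable[OF f square_integrable_continuous[OF continuous_on_poly_scaled]] by simp
  have mn: "integrable ?M (\<lambda>t. ?P n t * ?P m t)" for n
    by (intro continuous_imp_integrable_real continuous_intros continuous_on_poly_scaled)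
  have orth: "(LINT t|?M. ?P n t * ?P m t) = (if n = m then 2 * x / (2 * real m + 1) else 0)" for n
    using integral_poly_scaled[OF x, of "legendre n * legendre m"]
    by (simp add: poly_int_legendre add.commute mult.commute)
  have "(LINT t|?M. (f t - legendre_sum x f N t) * ?P m t) =
      (LINT t|?M. f t * ?P m t - (\<Sum>n<N. legendre_coeff x f n * (?P n t * ?P m t)))"
    by (intro Bochner_Integration.integral_cong refl)
       (simp add: legendre_sum_def algebra_simps sum_distrib_left)
  also have "\<dots> = (LINT t|?M. f t * ?P m t) - (\<Sum>n<N. legendre_coeff x f n * (LINT t|?M. ?P n t * ?P m t))"
    using fm mn by (simp add: Bochner_Integration.integral_diff Bochner_Integration.integral_sum)
  also have "\<dots> = (LINT t|?M. f t * ?P m t) - legendre_coeff x f m * (2 * x / (2 * real m + 1))"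
    using m by (simp add: orth if_distrib sum.delta cong: if_cong)
  also have "\<dots> = 0"
  proof -
    have "legendre_coeff x f m = (2 * real m + 1) / (2 * x) * (LINT t|?M. f t * ?P m t)"
      by (simp add: legendre_coeff_def mult.commute)
    moreover have "2 * real m + 1 \<noteq> 0"
      by linarith
    ultimately show ?thesis
      using x by simp
  qed
  finally show ?thesis .
qed

lemma legendre_error_orthogonal:
  fixes f :: "real \<Rightarrow> real"
  assumes x: "x > 0" and f: "square_integrable (lebesgue_on {-x..x}) f" and q: "degree q < N"
  shows "(LINT t|lebesgue_on {-x..x}. (f t - legendre_sum x f N t) * poly q (t / x)) = 0"
proof -
  let ?M = "lebesgue_on {-x..x}"
  obtain a where a: "q = (\<Sum>n<N. smult (a n) (legendre n))"
    using poly_eq_sum_legendre[OF q] by blast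
  have i: "integrable ?M (\<lambda>t. (f t - legendre_sum x f N t) * legendre_P n (t / x))" for n
    using square_integrable_scaleR_integrable[OF square_integrable_legendre_error[OF f]
        square_integrable_continuous[OF continuous_on_poly_scaled]] by simp
  have "(LINT t|?M. (f t - legendre_sum x f N t) * poly q (t / x)) =
      (LINT t|?M. (\<Sum>n<N. a n * ((f t - legendre_sum x f N t) * legendre_P n (t / x))))"
    by (simp add: a poly_sum sum_distrib_left mult_ac)
  also have "\<dots> = (\<Sum>n<N. a n * (LINT t|?M. (f t - legendre_sum x f N t) * legendre_P n (t / x)))"
    using i by (simp add: Bochner_Integration.integral_sum)
  also have "\<dots> = 0"
    by (simp add: legendre_error_orthogonal_legendre[OF x f])
  finally show ?thesis .
qed

text \<open>Stated for \<open>Suc N\<close> because a strict bound on the degree of the empty sum is impossible.\<close>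

lemma legendre_sum_real_is_poly:
  fixes f :: "real \<Rightarrow> real"
  obtains s where "degree s < Suc N" "legendre_sum x f (Suc N) = (\<lambda>t. poly s (t / x))"
proof
  let ?s = "\<Sum>n<Suc N. smult (legendre_coeff x f n) (legendre n)"
  show "degree ?s < Suc N"
    by (rule degree_sum_less) (auto intro: le_less_trans[OF degree_smult_le] simp: degree_legendre)
  show "legendre_sum x f (Suc N) = (\<lambda>t. poly ?s (t / x))"
    by (simp add: legendre_sum_def fun_eq_iff poly_sum mult.commute del: sum.lessThan_Suc)
qed

text \<open>
  Pythagoras: \<open>f - q\<close> is the sum of the error of the partial sum and a polynomial of degree below
  \<open>N\<close>, to which the error is orthogonal.
\<close>

lemma legendre_sum_best_approximation:
  fixes f :: "real \<Rightarrow> real"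
  assumes x: "x > 0" and f: "square_integrable (lebesgue_on {-x..x}) f" and q: "degree q < N"
  shows "(LINT t|lebesgue_on {-x..x}. (f t - legendre_sum x f N t)\<^sup>2)
    \<le> (LINT t|lebesgue_on {-x..x}. (f t - poly q (t / x))\<^sup>2)"
proof -
  let ?M = "lebesgue_on {-x..x}"
  let ?e = "\<lambda>t. f t - legendre_sum x f N t"
  obtain s where s: "degree s < N" "legendre_sum x f N = (\<lambda>t. poly s (t / x))"
    using legendre_sum_real_is_poly q by (metis less_imp_Suc_add)
  let ?r = "\<lambda>t. poly (s - q) (t / x)"
  have deg: "degree (s - q) < N"
    using s q by (simp add: degree_diff_less)
  have e: "square_integrable ?M ?e"
    by (rule square_integrable_legendre_error[OF f])
  have r: "square_integrable ?M ?r"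
    by (intro square_integrable_continuous continuous_on_poly_scaled)
  have er: "integrable ?M (\<lambda>t. ?e t * ?r t)"
    using square_integrable_scaleR_integrable[OF e r] by simp
  have "(LINT t|?M. (f t - poly q (t / x))\<^sup>2) = (LINT t|?M. (?e t)\<^sup>2 + 2 * (?e t * ?r t) + (?r t)\<^sup>2)"
    by (intro Bochner_Integration.integral_cong refl) (simp add: s power2_eq_square algebra_simps)
  also have "\<dots> = (LINT t|?M. (?e t)\<^sup>2) + 2 * (LINT t|?M. ?e t * ?r t) + (LINT t|?M. (?r t)\<^sup>2)"
    using er square_integrable_real[OF e] square_integrable_real[OF r] by simp
  also have "(LINT t|?M. ?e t * ?r t) = 0"
    by (rule legendre_error_orthogonal[OF x f deg])
  finally show ?thesis
    by (simp add: Bochner_Integration.integral_nonneg)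
qed

section \<open>Mean convergence of Legendre series\<close>

text \<open>
  The truncations at height \<open>k\<close> are eventually equal to \<open>f\<close> at each point, and the errors
  are dominated by \<open>f\<close>; so dominated convergence applies.
\<close>

lemma square_integrable_near_truncation:
  fixes f :: "'s \<Rightarrow> real"
  assumes f: "square_integrable M f" and e: "e > 0"
  shows "\<exists>c\<ge>0. (LINT t|M. (f t - max (-c) (min c (f t)))\<^sup>2) < e"
proof -
  note [measurable] = square_integrable_measurable[OF f]
  have "(\<lambda>k. LINT t|M. (f t - max (- real k) (min (real k) (f t)))\<^sup>2) \<longlonglongrightarrow> (LINT t|M. 0)"
  proof (rule integral_dominated_convergence)
    show "integrable M (\<lambda>t. (f t)\<^sup>2)"
      by (rule square_integrable_real[OF f])
    show "AE t in M. (\<lambda>k. (f t - max (- real k) (min (real k) (f t)))\<^sup>2) \<longlonglongrightarrow> 0"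
    proof (intro AE_I2 tendsto_eventually)
      fix t
      show "\<forall>\<^sub>F k in sequentially. (f t - max (- real k) (min (real k) (f t)))\<^sup>2 = 0"
        using eventually_ge_at_top[of "nat \<lceil>\<bar>f t\<bar>\<rceil>"]
        by eventually_elim (auto simp: max_def min_def)
    qed
    show "AE t in M. norm ((f t - max (- real k) (min (real k) (f t)))\<^sup>2) \<le> (f t)\<^sup>2" for k
      by (intro AE_I2) (auto simp: max_def min_def abs_le_square_iff[symmetric])
  qed auto
  then have "\<forall>\<^sub>F k in sequentially. (LINT t|M. (f t - max (- real k) (min (real k) (f t)))\<^sup>2) < e"
    using e by (intro order_tendstoD) auto
  then obtain k where "(LINT t|M. (f t - max (- real k) (min (real k) (f t)))\<^sup>2) < e"
    by (auto dest: eventually_happens)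
  then show ?thesis
    by (intro exI[of _ "real k"]) simp
qed

text \<open>
  A measurable function is an almost everywhere limit of continuous functions. These may be
  truncated at the same height as \<open>f\<close>, which keeps them continuous and makes a constant a dominating
  function.
\<close>

lemma truncation_near_continuous:
  fixes f :: "real \<Rightarrow> real"
  assumes f: "f \<in> borel_measurable (lebesgue_on {a..b})" and c: "c \<ge> 0" and e: "e > 0"
  shows "\<exists>g. continuous_on UNIV g \<and>
    (LINT t|lebesgue_on {a..b}. (max (-c) (min c (f t)) - g t)\<^sup>2) < e"
proof -
  let ?M = "lebesgue_on {a..b}"
  let ?T = "\<lambda>y. max (-c) (min c y) :: real"
  have "f measurable_on {a..b}"
    using f by (simp add: measurable_on_iff_borel_measurable)
  then obtain N g where N: "negligible N" and g: "\<And>n. continuous_on UNIV (g n)"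
    and lim: "\<And>t. t \<notin> N \<Longrightarrow> (\<lambda>n. g n t) \<longlonglongrightarrow> (if t \<in> {a..b} then f t else 0)"
    unfolding measurable_on_def by blast
  have [measurable]: "g n \<in> borel_measurable ?M" for n
    using g by (intro continuous_imp_measurable_on_sets_lebesgue) (auto intro: continuous_on_subset)
  note [measurable] = f
  have "(\<lambda>n. LINT t|?M. (?T (f t) - ?T (g n t))\<^sup>2) \<longlonglongrightarrow> (LINT t|?M. 0)"
  proof (rule integral_dominated_convergence)
    show "integrable ?M (\<lambda>t. (2 * c)\<^sup>2)"
      by (intro continuous_imp_integrable_real continuous_intros)
    have "AE t in lebesgue. t \<notin> N"
      using N by (simp add: AE_not_in negligible_iff_null_sets)
    then have "AE t in ?M. t \<in> {a..b} \<and> t \<notin> N"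
      by (auto simp: AE_restrict_space_iff elim!: eventually_mono)
    then show "AE t in ?M. (\<lambda>n. (?T (f t) - ?T (g n t))\<^sup>2) \<longlonglongrightarrow> 0"
    proof eventually_elim
      case (elim t)
      then have "(\<lambda>n. g n t) \<longlonglongrightarrow> f t"
        using lim[of t] by simp
      then have "(\<lambda>n. (?T (f t) - ?T (g n t))\<^sup>2) \<longlonglongrightarrow> (?T (f t) - ?T (f t))\<^sup>2"
        by (intro tendsto_intros)
      then show ?case
        by simp
    qed
    show "AE t in ?M. norm ((?T (f t) - ?T (g n t))\<^sup>2) \<le> (2 * c)\<^sup>2" for n
    proof (rule AE_I2)
      fix t
      have "\<bar>?T (f t) - ?T (g n t)\<bar> \<le> 2 * c"
        using c by (auto simp: max_def min_def)
      then show "norm ((?T (f t) - ?T (g n t))\<^sup>2) \<le> (2 * c)\<^sup>2"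
        using c power2_le_iff_abs_le[of "2 * c" "?T (f t) - ?T (g n t)"] by simp
    qed
  qed auto
  then have "\<forall>\<^sub>F n in sequentially. (LINT t|?M. (?T (f t) - ?T (g n t))\<^sup>2) < e"
    using e by (intro order_tendstoD) auto
  then obtain n where "(LINT t|?M. (?T (f t) - ?T (g n t))\<^sup>2) < e"
    by (auto dest: eventually_happens)
  moreover have "continuous_on UNIV (\<lambda>t. ?T (g n t))"
    by (intro continuous_intros g)
  ultimately show ?thesis
    by blast
qed

text \<open>Weierstrass' theorem, rescaled to polynomials in \<open>t / x\<close>.\<close>

lemma continuous_near_poly:
  fixes g :: "real \<Rightarrow> real"
  assumes g: "continuous_on {-x..x} g" and x: "x > 0" and d: "d > 0"
  shows "\<exists>q. \<forall>t\<in>{-x..x}. \<bar>g t - poly q (t / x)\<bar> < d"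
proof -
  have "continuous_on {-1..1} (\<lambda>s. g (x * s))"
    using x by (intro continuous_on_compose2[OF g] continuous_intros)
      (auto simp: mult_le_cancel_left1 mult_minus_right[symmetric] simp del: mult_minus_right
        intro: mult_left_mono[of "-1" _ x, simplified])
  then obtain h where h: "real_polynomial_function h" "\<And>s. s \<in> {-1..1} \<Longrightarrow> \<bar>g (x * s) - h s\<bar> < d"
    using Stone_Weierstrass_real_polynomial_function[of "{-1..1}" "\<lambda>s. g (x * s)" d] d by auto
  then obtain a n where "h = (\<lambda>s. \<Sum>i\<le>n. a i * s ^ i)"
    by (auto simp: real_polynomial_function_iff_sum)
  then have "h s = poly (\<Sum>i\<le>n. monom (a i) i) s" for s
    by (simp add: poly_sum poly_monom)
  moreover have "\<bar>g t - h (t / x)\<bar> < d" if "t \<in> {-x..x}" for t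
    using h(2)[of "t / x"] that x by (simp add: field_simps)
  ultimately show ?thesis
    by (intro exI[of _ "\<Sum>i\<le>n. monom (a i) i"]) simp
qed

text \<open>
  The three errors, of truncation, of approximation by a continuous function and of uniform
  approximation by a polynomial, are combined by \<open>(u + v)\<^sup>2 \<le> 2 u\<^sup>2 + 2 v\<^sup>2\<close>, used twice.
\<close>

lemma polynomials_dense_L2:
  fixes f :: "real \<Rightarrow> real"
  assumes x: "x > 0" and f: "square_integrable (lebesgue_on {-x..x}) f" and e: "e > 0"
  shows "\<exists>q. (LINT t|lebesgue_on {-x..x}. (f t - poly q (t / x))\<^sup>2) < e"
proof -
  let ?M = "lebesgue_on {-x..x}"
  obtain c where c: "c \<ge> 0" "(LINT t|?M. (f t - max (-c) (min c (f t)))\<^sup>2) < e / 8"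
    using square_integrable_near_truncation[OF f, of "e / 8"] e by auto
  let ?h = "\<lambda>t. max (-c) (min c (f t))"
  obtain g where g: "continuous_on UNIV g" "(LINT t|?M. (?h t - g t)\<^sup>2) < e / 16"
    using truncation_near_continuous[OF square_integrable_measurable[OF f] c(1), of "e / 16"] e by auto
  \<comment> \<open>The bounds \<open>e / 8\<close>, \<open>e / 16\<close> and \<open>d\<^sup>2\<close> enter with factors 2, 4 and \<open>8 x\<close> (the interval
    has length \<open>2 x\<close>), so each part contributes at most \<open>e / 4\<close>.\<close>
  define d where "d = sqrt (e / (32 * x))"
  have d: "d > 0" "d\<^sup>2 = e / (32 * x)"
    using e x by (auto simp: d_def)
  have cg: "continuous_on {-x..x} g"
    using g(1) by (rule continuous_on_subset) simp
  obtain q where q: "\<And>t. t \<in> {-x..x} \<Longrightarrow> \<bar>g t - poly q (t / x)\<bar> < d"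
    using continuous_near_poly[OF cg x d(1)] by blast
  note [measurable] = square_integrable_measurable[OF f]
  have h: "square_integrable ?M ?h"
    by (rule square_integrableI_bound[OF _ square_integrable_real[OF f]])
       (use c in \<open>auto simp: max_def min_def abs_le_square_iff[symmetric]\<close>)
  have sg: "square_integrable ?M g" and sq: "square_integrable ?M (\<lambda>t. poly q (t / x))"
    by (intro square_integrable_continuous cg continuous_on_poly_scaled)+
  note int = square_integrable_real[OF square_integrable_diff]
  have vol: "(LINT t|?M. d\<^sup>2) = 2 * x * d\<^sup>2"
    using x by (simp add: measure_restrict_space)
  have "(LINT t|?M. (f t - poly q (t / x))\<^sup>2)
      \<le> (LINT t|?M. 2 * (f t - ?h t)\<^sup>2 + 4 * (?h t - g t)\<^sup>2 + 4 * d\<^sup>2)"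
  proof (rule integral_mono)
    show "integrable ?M (\<lambda>t. (f t - poly q (t / x))\<^sup>2)"
      by (rule int[OF f sq])
    show "integrable ?M (\<lambda>t. 2 * (f t - ?h t)\<^sup>2 + 4 * (?h t - g t)\<^sup>2 + 4 * d\<^sup>2)"
      by (intro Bochner_Integration.integrable_add Bochner_Integration.integrable_mult_right
          int[OF f h] int[OF h sg] continuous_imp_integrable_real continuous_intros)
    fix t assume "t \<in> space ?M"
    then have "(g t - poly q (t / x))\<^sup>2 \<le> d\<^sup>2"
      using q[of t] d(1) by (intro power2_le_iff_abs_le[THEN iffD2]) auto
    then show "(f t - poly q (t / x))\<^sup>2 \<le> 2 * (f t - ?h t)\<^sup>2 + 4 * (?h t - g t)\<^sup>2 + 4 * d\<^sup>2"
      using norm_add_square_le[of "f t - ?h t" "?h t - poly q (t / x)"]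
        norm_add_square_le[of "?h t - g t" "g t - poly q (t / x)"] by simp
  qed
  also have "\<dots> = 2 * (LINT t|?M. (f t - ?h t)\<^sup>2) + 4 * (LINT t|?M. (?h t - g t)\<^sup>2) + 4 * (2 * x * d\<^sup>2)"
    unfolding vol[symmetric]
    using int[OF f h] int[OF h sg] continuous_imp_integrable_real[of "-x" x "\<lambda>_. d\<^sup>2"] by simp
  also have "\<dots> < e"
    using c(2) g(2) x e by (simp add: d(2))
  finally show ?thesis
    by blast
qed

lemma legendre_sum_tendsto_real:
  fixes f :: "real \<Rightarrow> real"
  assumes x: "x > 0" and f: "square_integrable (lebesgue_on {-x..x}) f"
  shows "(\<lambda>N. LINT t|lebesgue_on {-x..x}. (f t - legendre_sum x f N t)\<^sup>2) \<longlonglongrightarrow> 0"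
proof (rule LIMSEQ_I)
  fix e :: real assume "e > 0"
  then obtain q where q: "(LINT t|lebesgue_on {-x..x}. (f t - poly q (t / x))\<^sup>2) < e"
    using polynomials_dense_L2[OF x f] by blast
  have "norm ((LINT t|lebesgue_on {-x..x}. (f t - legendre_sum x f N t)\<^sup>2) - 0) < e"
    if "N \<ge> Suc (degree q)" for N
    using legendre_sum_best_approximation[OF x f, of q N] q that by simp
  then show "\<exists>N0. \<forall>N\<ge>N0. norm ((LINT t|lebesgue_on {-x..x}. (f t - legendre_sum x f N t)\<^sup>2) - 0) < e"
    by blast
qed

lemma inner_legendre_sum:
  assumes "square_integrable (lebesgue_on {-x..x}) f"
  shows "legendre_sum x f N t \<bullet> b = legendre_sum x (\<lambda>t. f t \<bullet> b) N t"
proof -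
  have "integrable (lebesgue_on {-x..x}) (\<lambda>t. legendre_P n (t / x) *\<^sub>R f t)" for n
    by (intro square_integrable_scaleR_integrable assms square_integrable_continuous continuous_on_poly_scaled)
  then have "legendre_coeff x f n \<bullet> b = legendre_coeff x (\<lambda>t. f t \<bullet> b) n" for n
    by (simp add: legendre_coeff_def flip: integral_inner_left)
  then show ?thesis
    by (simp add: legendre_sum_def inner_sum_left)
qed

text \<open>
  Forming the partial sum commutes with taking coordinates, and the square of the norm is the sum of
  the squares of the coordinates.
\<close>

theorem legendre_sum_tendsto:
  assumes x: "x > 0" and f: "square_integrable (lebesgue_on {-x..x}) f"
  shows "(\<lambda>N. LINT t|lebesgue_on {-x..x}. (norm (f t - legendre_sum x f N t))\<^sup>2) \<longlonglongrightarrow> 0"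
proof -
  let ?M = "lebesgue_on {-x..x}"
  have comp: "square_integrable ?M (\<lambda>t. f t \<bullet> b)" for b
    by (rule square_integrable_linear[OF f bounded_linear_inner_left])
  have "(LINT t|?M. (norm (f t - legendre_sum x f N t))\<^sup>2) =
      (\<Sum>b\<in>Basis. LINT t|?M. (f t \<bullet> b - legendre_sum x (\<lambda>t. f t \<bullet> b) N t)\<^sup>2)" for N
  proof -
    have "(norm (f t - legendre_sum x f N t))\<^sup>2 =
        (\<Sum>b\<in>Basis. (f t \<bullet> b - legendre_sum x (\<lambda>t. f t \<bullet> b) N t)\<^sup>2)" for t
      unfolding power2_norm_eq_inner
      by (subst euclidean_inner) (simp add: inner_diff_left inner_legendre_sum[OF f] power2_eq_square)
    then show ?thesis
      using square_integrable_real[OF square_integrable_legendre_error[OF comp]]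
      by (simp add: Bochner_Integration.integral_sum)
  qed
  then show ?thesis
    using legendre_sum_tendsto_real[OF x comp] by (auto intro!: tendsto_null_sum)
qed

section \<open>Operator norm and Euclidean norm of matrices\<close>

lemma bounded_linear_matrix_vector_mult_complex:
  "bounded_linear ((*v) (A :: complex^'n^'m))"
proof -
  have "linear ((*v) A)"
    by (rule linearI)
       (simp_all add: vec_eq_iff matrix_vector_mult_def algebra_simps sum.distrib scaleR_right.sum)
  then show ?thesis
    by (simp add: linear_conv_bounded_linear)
qed

lemma opnorm_le_norm: "opnorm A \<le> 4 * norm A"
  unfolding opnorm_def
proof (rule onorm_le)
  fix v :: "complex^2"
  have "norm (A *v v) \<le> (\<Sum>i\<in>UNIV. \<Sum>j\<in>UNIV. norm (A $ i $ j) * norm (v $ j))"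
    unfolding norm_vec_def matrix_vector_mult_def
    by (rule order_trans[OF L2_set_le_sum]) 
       (auto intro!: sum_mono order_trans[OF norm_sum] simp: norm_mult)
  also have "\<dots> \<le> (\<Sum>i::2\<in>UNIV. \<Sum>j::2\<in>UNIV. norm A * norm v)"
    by (intro sum_mono mult_mono Finite_Cartesian_Product.norm_nth_le order_trans[OF Finite_Cartesian_Product.norm_nth_le Finite_Cartesian_Product.norm_nth_le]) auto
  finally show "norm (A *v v) \<le> 4 * norm A * norm v"
    by simp
qed

lemma norm_le_opnorm: "norm A \<le> 4 * opnorm A"
proof -
  have entry: "norm (A $ i $ j) \<le> opnorm A" for i j
  proof -
    have "A $ i $ j = (A *v axis j 1) $ i"
      by (simp add: matrix_vector_mult_def axis_def if_distrib cong: if_cong)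
    then have "norm (A $ i $ j) \<le> norm (A *v axis j 1)"
      by (simp add: Finite_Cartesian_Product.norm_nth_le)
    also have "\<dots> \<le> opnorm A * norm (axis j 1 :: complex^2)"
      unfolding opnorm_def by (rule onorm[OF bounded_linear_matrix_vector_mult_complex])
    finally show ?thesis
      by simp
  qed
  have "norm A \<le> (\<Sum>i\<in>UNIV. \<Sum>j\<in>UNIV. norm (A $ i $ j))"
    unfolding norm_vec_def
    by (intro order_trans[OF L2_set_le_sum] sum_mono) auto
  also have "\<dots> \<le> (\<Sum>i::2\<in>UNIV. \<Sum>j::2\<in>UNIV. opnorm A)"
    by (intro sum_mono entry)
  finally show ?thesis
    by simp
qed

lemma opnorm_nonneg: "0 \<le> opnorm A"
  unfolding opnorm_def by (rule onorm_pos_le[OF bounded_linear_matrix_vector_mult_complex])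

lemma opnorm_triangle: "opnorm (A + B) \<le> opnorm A + opnorm B"
  unfolding opnorm_def matrix_vector_mult_add_rdistrib
  by (rule onorm_triangle) (rule bounded_linear_matrix_vector_mult_complex)+

lemma continuous_on_opnorm: "continuous_on S opnorm"
proof -
  have "4-lipschitz_on S opnorm"
  proof (rule lipschitz_onI)
    fix A B :: cmat2
    have "opnorm A - opnorm B \<le> 4 * norm (A - B)" for A B
      using opnorm_triangle[of "A - B" B] opnorm_le_norm[of "A - B"] by simp
    from this[of A B] this[of B A] show "dist (opnorm A) (opnorm B) \<le> 4 * dist A B"
      by (simp add: dist_norm norm_minus_commute abs_le_iff)
  qed simp
  then show ?thesis
    by (rule lipschitz_on_continuous_on)
qed

text \<open>
  The two norms are equivalent, and the operator norm is a continuous, hence measurable, function of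
  the matrix.
\<close>

lemma L2_mat_iff: "A \<in> L2_mat a b \<longleftrightarrow> square_integrable (lebesgue_on {a..b}) A"
proof
  assume A: "A \<in> L2_mat a b"
  show "square_integrable (lebesgue_on {a..b}) A"
  proof (rule square_integrableI_bound)
    show "integrable (lebesgue_on {a..b}) (\<lambda>t. 16 * (opnorm (A t))\<^sup>2)"
      using A by (simp add: L2_mat_def)
    show "(norm (A t))\<^sup>2 \<le> 16 * (opnorm (A t))\<^sup>2" for t
      using power_mono[OF norm_le_opnorm[of "A t"], of 2] by (simp add: power_mult_distrib)
  qed (use A in \<open>simp add: L2_mat_def\<close>)
next
  assume A: "square_integrable (lebesgue_on {a..b}) A"
  have "square_integrable (lebesgue_on {a..b}) (\<lambda>t. opnorm (A t))"
  proof (rule square_integrableI_bound)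
    show "(\<lambda>t. opnorm (A t)) \<in> borel_measurable (lebesgue_on {a..b})"
      using measurable_compose[OF square_integrable_measurable[OF A]
          borel_measurable_continuous_onI[OF continuous_on_opnorm]] .
    show "integrable (lebesgue_on {a..b}) (\<lambda>t. 16 * (norm (A t))\<^sup>2)"
      using square_integrable_norm[OF A] by simp
    show "(norm (opnorm (A t)))\<^sup>2 \<le> 16 * (norm (A t))\<^sup>2" for t
      using power_mono[OF opnorm_le_norm[of "A t"] opnorm_nonneg, of 2] by (simp add: power_mult_distrib)
  qed
  then show "A \<in> L2_mat a b"
    using A by (auto simp: L2_mat_def square_integrable_def)
qed

lemma L2_convergesI:
  assumes A: "square_integrable (lebesgue_on {a..b}) A"
    and F: "\<And>N. square_integrable (lebesgue_on {a..b}) (F N)"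
    and lim: "(\<lambda>N. LINT t|lebesgue_on {a..b}. (norm (F N t - A t))\<^sup>2) \<longlonglongrightarrow> 0"
  shows "L2_converges a b F A"
  unfolding L2_converges_def L2_mat_iff
proof (intro conjI allI A F)
  let ?M = "lebesgue_on {a..b}"
  have "(\<lambda>N. LINT t|?M. (opnorm (F N t - A t))\<^sup>2) \<longlonglongrightarrow> 0"
  proof (rule tendsto_sandwich[OF _ _ tendsto_const])
    show "(\<lambda>N. 16 * (LINT t|?M. (norm (F N t - A t))\<^sup>2)) \<longlonglongrightarrow> 0"
      using tendsto_mult_left[OF lim, of 16] by simp
    show "\<forall>\<^sub>F N in sequentially.
        (LINT t|?M. (opnorm (F N t - A t))\<^sup>2) \<le> 16 * (LINT t|?M. (norm (F N t - A t))\<^sup>2)"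
    proof (rule always_eventually, rule allI)
      fix N
      have d: "square_integrable ?M (\<lambda>t. F N t - A t)"
        by (intro square_integrable_diff A F)
      then have "(LINT t|?M. (opnorm (F N t - A t))\<^sup>2) \<le> (LINT t|?M. 16 * (norm (F N t - A t))\<^sup>2)"
      proof (intro integral_mono)
        show "integrable ?M (\<lambda>t. (opnorm (F N t - A t))\<^sup>2)"
          using L2_mat_iff[THEN iffD2, OF d] by (simp add: L2_mat_def)
        show "(opnorm (F N t - A t))\<^sup>2 \<le> 16 * (norm (F N t - A t))\<^sup>2" for t
          using power_mono[OF opnorm_le_norm opnorm_nonneg, of "F N t - A t" 2]
          by (simp add: power_mult_distrib)
      qed (simp add: square_integrable_norm)
      then show "(LINT t|?M. (opnorm (F N t - A t))\<^sup>2) \<le> 16 * (LINT t|?M. (norm (F N t - A t))\<^sup>2)"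
        by simp
    qed
  qed (auto intro!: always_eventually Bochner_Integration.integral_nonneg)
  then show "(\<lambda>N. L2_norm a b (\<lambda>t. F N t - A t)) \<longlonglongrightarrow> 0"
    unfolding L2_norm_def using tendsto_real_sqrt by fastforce
qed

section \<open>Folding an expansion onto the half interval\<close>

text \<open>
  The square mean over \<open>[0, x]\<close> is at most that over \<open>[-x, x]\<close>. There both summands of the
  folded function have at most the square mean of \<open>f\<close>, since \<open>h\<close> is a contraction and \<open>t \<mapsto> -t\<close>
  preserves the measure.
\<close>

lemma square_integrable_fold:
  fixes f :: "real \<Rightarrow> 'a::euclidean_space" and h :: "'a \<Rightarrow> 'a"
  assumes f: "square_integrable (lebesgue_on {-x..x}) f" and h: "bounded_linear h"
    and h_norm: "\<And>v. norm (h v) \<le> norm v" and x: "0 \<le> x"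
  shows "square_integrable (lebesgue_on {0..x}) (\<lambda>t. f t + h (f (- t)))" (is ?sq)
    and "(LINT t|lebesgue_on {0..x}. (norm (f t + h (f (- t))))\<^sup>2)
      \<le> 4 * (LINT t|lebesgue_on {-x..x}. (norm (f t))\<^sup>2)" (is ?le)
proof -
  let ?M = "lebesgue_on {-x..x}"
  let ?g = "\<lambda>t. f t + h (f (- t))"
  have fm: "square_integrable ?M (\<lambda>t. f (- t))"
    unfolding square_integrable_def
    using integrable_reflect_real[of x "-x" f] square_integrable_imp_integrable[OF f]
      integrable_reflect_real[of x "-x" "\<lambda>t. (norm (f t))\<^sup>2"] square_integrable_norm[OF f]
    by (simp add: borel_measurable_integrable)
  have g: "square_integrable ?M ?g"
    by (intro square_integrable_add f square_integrable_linear[OF fm h])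
  have sub: "{0..x} \<subseteq> {-x..x}"
    using x by auto
  have "integrable (lebesgue_on {0..x}) (\<lambda>t. (norm (?g t))\<^sup>2)"
    using set_integrable_subset[of lebesgue "{-x..x}" "\<lambda>t. (norm (?g t))\<^sup>2" "{0..x}"] sub
      square_integrable_norm[OF g]
    by (simp add: set_integrable_def integrable_restrict_space)
  then show ?sq
    unfolding square_integrable_def
    using measurable_restrict_mono[OF square_integrable_measurable[OF g] sub] by simp
  have "(LINT t|lebesgue_on {0..x}. (norm (?g t))\<^sup>2) \<le> (LINT t|?M. (norm (?g t))\<^sup>2)"
    using sub by (intro integral_mono_lebesgue_on_AE square_integrable_norm[OF g]) auto
  also have "\<dots> \<le> (LINT t|?M. 2 * (norm (f t))\<^sup>2 + 2 * (norm (f (- t)))\<^sup>2)"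
  proof (rule integral_mono)
    show "(norm (?g t))\<^sup>2 \<le> 2 * (norm (f t))\<^sup>2 + 2 * (norm (f (- t)))\<^sup>2" for t
      using norm_add_square_le[of "f t" "h (f (- t))"] power_mono[OF h_norm[of "f (- t)"] norm_ge_zero, of 2]
      by linarith
  qed (use f fm g in \<open>auto intro!: square_integrable_norm\<close>)
  also have "\<dots> = 2 * (LINT t|?M. (norm (f t))\<^sup>2) + 2 * (LINT t|?M. (norm (f (- t)))\<^sup>2)"
    using square_integrable_norm[OF f] square_integrable_norm[OF fm] by simp
  also have "(LINT t|?M. (norm (f (- t)))\<^sup>2) = (LINT t|?M. (norm (f t))\<^sup>2)"
    using integral_reflect_real[of x "-x" "\<lambda>t. (norm (f t))\<^sup>2"] by simp
  finally show ?le
    by simp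
qed

text \<open>
  Folding is linear, so the error of the folded partial sum is the folded error of the partial sum.
  Only partial sums of even length occur because each term of the folded series pairs an
  even and an odd Legendre polynomial.
\<close>

lemma folded_legendre_sum_L2_converges:
  fixes f :: "real \<Rightarrow> cmat2"
  assumes x: "x > 0" and f: "square_integrable (lebesgue_on {-x..x}) f" and h: "bounded_linear h"
    and h_norm: "\<And>v. norm (h v) \<le> norm v"
  shows "L2_converges 0 x
    (\<lambda>N t. legendre_sum x f (2 * N) t + h (legendre_sum x f (2 * N) (- t))) (\<lambda>t. f t + h (f (- t)))"
proof (rule L2_convergesI)
  interpret h: bounded_linear h
    by (rule h)
  let ?S = "\<lambda>N. legendre_sum x f (2 * N)"
  let ?e = "\<lambda>N t. f t - ?S N t"
  have S: "square_integrable (lebesgue_on {-x..x}) (?S N)" for N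
    by (intro square_integrable_continuous continuous_on_legendre_sum)
  show "square_integrable (lebesgue_on {0..x}) (\<lambda>t. f t + h (f (- t)))"
    using square_integrable_fold(1)[OF f h h_norm] x by simp
  show "square_integrable (lebesgue_on {0..x}) (\<lambda>t. ?S N t + h (?S N (- t)))" for N
    using square_integrable_fold(1)[OF S h h_norm] x by simp
  have fold: "(norm (?S N t + h (?S N (- t)) - (f t + h (f (- t)))))\<^sup>2 =
      (norm (?e N t + h (?e N (- t))))\<^sup>2" for N t
    by (subst norm_minus_commute) (simp add: h.diff algebra_simps)
  have "(\<lambda>N. LINT t|lebesgue_on {-x..x}. (norm (?e N t))\<^sup>2) \<longlonglongrightarrow> 0"
    using LIMSEQ_subseq_LIMSEQ[OF legendre_sum_tendsto[OF x f], of "\<lambda>N. 2 * N"]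
    by (simp add: strict_mono_def o_def)
  then have lim: "(\<lambda>N. 4 * (LINT t|lebesgue_on {-x..x}. (norm (?e N t))\<^sup>2)) \<longlonglongrightarrow> 0"
    by (rule tendsto_mult_right_zero)
  show "(\<lambda>N. LINT t|lebesgue_on {0..x}. (norm (?S N t + h (?S N (- t)) - (f t + h (f (- t)))))\<^sup>2) \<longlonglongrightarrow> 0"
    unfolding fold
    by (rule tendsto_sandwich[OF _ _ tendsto_const lim])
       (use square_integrable_fold(2)[OF square_integrable_legendre_error[OF f] h h_norm] x
        in \<open>auto intro!: always_eventually Bochner_Integration.integral_nonneg\<close>)
qed

lemma bounded_linear_times_sigma2: "bounded_linear (\<lambda>X. X ** sigma2)"
proof -
  have "linear (\<lambda>X. X ** sigma2)"
    by (rule linearI)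
       (simp_all add: vec_eq_iff matrix_matrix_mult_def algebra_simps sum.distrib scaleR_right.sum)
  then show ?thesis
    by (simp add: linear_conv_bounded_linear)
qed

lemma norm_times_sigma2: "norm (X ** sigma2) = norm X"
  by (simp add: norm_vec_def L2_set_def sum_2 matrix_matrix_mult_def sigma2_def mat2_def)

lemma legendre_coeff_kernel:
  "legendre_coeff x (K x) n = (1 / x) *\<^sub>R K_coeff K n x"
  by (simp add: legendre_coeff_def K_coeff_def add.commute mult.commute)

text \<open>
  Right multiplication by \<open>sigma2\<close> keeps the first column and negates the second. With the parity of
  \<open>P\<^sub>n\<close>, the even terms therefore survive in the first column and the odd terms in the second.
\<close>

lemma KC_sum_eq_folded_legendre_sum:
  "2 *\<^sub>R (\<Sum>n<N. (1/x) *\<^sub>R (KC_coeff K n x ** A_C n x t)) =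
    legendre_sum x (K x) (2 * N) t + legendre_sum x (K x) (2 * N) (- t) ** sigma2"
  unfolding legendre_sum_def legendre_coeff_kernel
  by (induction N)
     (simp_all add: vec_eq_iff forall_2 matrix_matrix_mult_def sum_2 mat2_def sigma2_def
       KC_coeff_def A_C_def legendre_minus scaleR_conv_of_real[where 'a = complex] algebra_simps)

text \<open>
  The sign of the reflected part is reversed, so the odd terms now survive in the first column and
  the even terms in the second.
\<close>

lemma KS_sum_eq_folded_legendre_sum:
  "2 *\<^sub>R (\<Sum>n<N. (1/x) *\<^sub>R (KS_coeff K n x ** A_S n x t)) =
    legendre_sum x (K x) (2 * N) t - legendre_sum x (K x) (2 * N) (- t) ** sigma2"
  unfolding legendre_sum_def legendre_coeff_kernel
  by (induction N)
     (simp_all add: vec_eq_iff forall_2 matrix_matrix_mult_def sum_2 mat2_def sigma2_def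
       KS_coeff_def A_S_def legendre_minus scaleR_conv_of_real[where 'a = complex] algebra_simps)

theorem proposition3p1:
  fixes p q :: "real \<Rightarrow> real"
    and U :: "complex \<Rightarrow> real \<Rightarrow> cmat2"
    and K :: "real \<Rightarrow> real \<Rightarrow> cmat2"
  assumes "p \<in> L2_real 0 1" and "q \<in> L2_real 0 1"
    and "\<And>lam. dirac_fundamental_solution p q lam (U lam)"
    and "transmutation_kernel U K"
  shows "\<forall>x\<in>{0<..1}.
      L2_converges 0 x
        (\<lambda>N t. 2 *\<^sub>R (\<Sum>n<N. (1/x) *\<^sub>R (KC_coeff K n x ** A_C n x t))) (K_C K x) \<and>
      L2_converges 0 x
        (\<lambda>N t. 2 *\<^sub>R (\<Sum>n<N. (1/x) *\<^sub>R (KS_coeff K n x ** A_S n x t))) (K_S K x)"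
proof
  fix x :: real
  assume x: "x \<in> {0<..1}"
  then have "K x \<in> L2_mat (-x) x"
    using assms(4) by (simp add: transmutation_kernel_def)
  then have K: "square_integrable (lebesgue_on {-x..x}) (K x)"
    by (simp add: L2_mat_iff)
  have pos: "x > 0"
    using x by simp
  have KC: "K_C K x = (\<lambda>t. K x t + K x (- t) ** sigma2)"
    and KS: "K_S K x = (\<lambda>t. K x t + - (K x (- t) ** sigma2))"
    by (simp_all add: K_C_def K_S_def fun_eq_iff)
  show "L2_converges 0 x
        (\<lambda>N t. 2 *\<^sub>R (\<Sum>n<N. (1/x) *\<^sub>R (KC_coeff K n x ** A_C n x t))) (K_C K x) \<and>
      L2_converges 0 x
        (\<lambda>N t. 2 *\<^sub>R (\<Sum>n<N. (1/x) *\<^sub>R (KS_coeff K n x ** A_S n x t))) (K_S K x)"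
    unfolding KC_sum_eq_folded_legendre_sum KS_sum_eq_folded_legendre_sum KC KS
    using folded_legendre_sum_L2_converges[OF pos K bounded_linear_times_sigma2]
      folded_legendre_sum_L2_converges[OF pos K bounded_linear_minus[OF bounded_linear_times_sigma2]]
    by (simp add: norm_times_sigma2)
qed

end
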